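(* Let $m$ be a positive integer, $M=\{1,\dots,m\}$, and let $P$ be a finite poset on a set $K$ disjoint from $\{1,\dots,m+1\}$. Let $\mathcal{F}'(M,P)$ be the set of triples $(D,U,f)$ with $D\in\mathcal{D}(P)$, $U$ an upset of the subposet $P-DP$, and $f\in\mathcal{F}(M,P-D)$. For such a triple define $f_{m+1}:K\to\mathcal{P}_0(M\cup\{m+1\})$ by $f_{m+1}(x)=\{m+1\}$ if $x\in D$, $f_{m+1}(x)=f(x)\cup\{m+1\}$ if $x\in(U\cup DP)\setminus D$, and $f_{m+1}(x)=f(x)$ if $x\in K\setminus(U\cup DP)$. Then $(D,U,f)\mapsto f_{m+1}$ is a bijection from $\mathcal{F}'(M,P)$ onto $\mathcal{F}(\{1,\dots,m+1\},P)$. Consequently $$e(m+1,P)=\sum_{D\in\mathcal{D}(P)} d(P-DP)\,e(m,P-D)=\sum_{U\in\mathcal{U}(P)} d(U^\circ)\,e(m,U).$$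
   Context: For a poset $Q$ on a set $L$ and a finite set $N$, $\mathcal{F}(N,Q)$ is the set of maps $f:L\to\mathcal{P}_0(N)$ (nonempty subsets of $N$) with $x\le_Q y\Rightarrow f(x)\subseteq f(y)$. For $S\subseteq K$, $SP$ is the up-closure $\{y\mid \exists s\in S: s\le_P y\}$; $P-S$ is the subposet induced on $K\setminus S$. $\mathcal{D}(P)$, $\mathcal{U}(P)$ are the sets of downsets, upsets; $d(\cdot)$ counts downsets. For $U\subseteq K$, $U^\circ=K\setminus (K\setminus U)P$, and $d(U^\circ)$, $e(m,U)$ refer to the subposets of $P$ induced on $U^\circ$, $U$. For a finite poset $Q$ on $L$ and $|N|=n$ with $N\cap L=\emptyset$, $e(n,Q)$ is the number of partial orders on $N\cup L$ inducing $Q$ on $L$ whose set of minimal elements is exactly $N$. *)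

theory Defs
  imports Main "HOL-Library.FuncSet"
begin

text \<open>
  A poset on a set \<open>K\<close> is a relation \<open>P\<close> with \<^term>\<open>partial_order_on K P\<close>. Reflexivity gives
  \<^term>\<open>Field P = K\<close>, so a poset is passed around as the relation alone, and the subposet induced
  on \<open>A \<subseteq> K\<close> is \<^term>\<open>Restr P A\<close>.
\<close>

lemma poset_on_Field: "partial_order_on K P \<Longrightarrow> Field P = K"
  by (auto simp: partial_order_on_def preorder_on_def refl_on_def Field_def)

lemma poset_on_Restr:
  "partial_order_on K P \<Longrightarrow> A \<subseteq> K \<Longrightarrow> partial_order_on A (Restr P A)"
  unfolding partial_order_on_def preorder_on_def refl_on_def antisym_def trans_def
  by (intro conjI) blast+

definition poset_minus :: "'a rel \<Rightarrow> 'a set \<Rightarrow> 'a rel" where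
  "poset_minus P S = Restr P (Field P - S)"

definition up_closure :: "'a rel \<Rightarrow> 'a set \<Rightarrow> 'a set" where
  "up_closure P S = {y. \<exists>s\<in>S. (s, y) \<in> P}"

definition downsets :: "'a rel \<Rightarrow> 'a set set" where
  "downsets P = {D. D \<subseteq> Field P \<and> (\<forall>x y. y \<in> D \<longrightarrow> (x, y) \<in> P \<longrightarrow> x \<in> D)}"

definition upsets :: "'a rel \<Rightarrow> 'a set set" where
  "upsets P = {U. U \<subseteq> Field P \<and> (\<forall>x y. x \<in> U \<longrightarrow> (x, y) \<in> P \<longrightarrow> y \<in> U)}"

definition num_downsets :: "'a rel \<Rightarrow> nat" where
  "num_downsets P = card (downsets P)"

definition up_interior :: "'a rel \<Rightarrow> 'a set \<Rightarrow> 'a set" where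
  "up_interior P U = Field P - up_closure P (Field P - U)"

definition minimal_elems :: "'a rel \<Rightarrow> 'a set" where
  "minimal_elems R = {x \<in> Field R. \<forall>y. (y, x) \<in> R \<longrightarrow> y = x}"

definition extension_orders :: "'a set \<Rightarrow> 'a rel \<Rightarrow> 'a rel set" where
  "extension_orders N Q =
    {R. partial_order_on (N \<union> Field Q) R \<and> Restr R (Field Q) = Q \<and> minimal_elems R = N}"

text \<open>
  For \<open>e(n,Q)\<close> a set \<open>N\<close> with \<open>n\<close> elements that is disjoint from \<open>Field Q\<close> is needed. The tagged
  copy of \<open>{1..n}\<close> in the sum type provides one, whatever the element type of \<open>Q\<close>; the
  lemma \<open>num_extensions_eq\<close> below shows that every other choice of \<open>N\<close> gives the same number.
\<close>

definition num_extensions :: "nat \<Rightarrow> 'a rel \<Rightarrow> nat" where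
  "num_extensions n Q =
    card (extension_orders (Inl ` {1..n} :: (nat + 'a) set) (map_prod Inr Inr ` Q))"

definition monotone_set_maps :: "'b set \<Rightarrow> 'a rel \<Rightarrow> ('a \<Rightarrow> 'b set) set" where
  "monotone_set_maps N Q =
    {f \<in> Field Q \<rightarrow>\<^sub>E (Pow N - {{}}). \<forall>(x, y) \<in> Q. f x \<subseteq> f y}"

definition map_triples ::
  "'b set \<Rightarrow> 'a rel \<Rightarrow> ('a set \<times> 'a set \<times> ('a \<Rightarrow> 'b set)) set" where
  "map_triples M P =
    {(D, U, f). D \<in> downsets P \<and> U \<in> upsets (poset_minus P (up_closure P D)) \<and>
      f \<in> monotone_set_maps M (poset_minus P D)}"

definition add_point_map ::
  "nat \<Rightarrow> 'a rel \<Rightarrow> 'a set \<times> 'a set \<times> ('a \<Rightarrow> nat set) \<Rightarrow> 'a \<Rightarrow> nat set" where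
  "add_point_map m P = (\<lambda>(D, U, f). \<lambda>x\<in>Field P.
    if x \<in> D then {m + 1}
    else if x \<in> U \<union> up_closure P D then f x \<union> {m + 1}
    else f x)"

lemma Field_map_prod_image: "Field (map_prod h h ` R) = h ` Field R"
  by (force simp: Field_def Domain_iff Range_iff)

lemma extension_orders_image:
  assumes inj: "inj_on h (N \<union> Field Q)" and R: "R \<in> extension_orders N Q"
  shows "map_prod h h ` R \<in> extension_orders (h ` N) (map_prod h h ` Q)"
proof -
  let ?A = "N \<union> Field Q"
  let ?S = "map_prod h h ` R"
  from R have po: "partial_order_on ?A R" and res: "Restr R (Field Q) = Q"
    and mi: "minimal_elems R = N"
    by (auto simp: extension_orders_def)
  have sub: "R \<subseteq> ?A \<times> ?A" and rf: "\<And>x. x \<in> ?A \<Longrightarrow> (x, x) \<in> R" and tr: "trans R"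
    and an: "antisym R"
    using po by (auto simp: partial_order_on_def preorder_on_def refl_on_def)
  have FR: "Field R = ?A" using poset_on_Field[OF po] .
  have iff: "(h x, h y) \<in> ?S \<longleftrightarrow> (x, y) \<in> R" if "x \<in> ?A" "y \<in> ?A" for x y
  proof
    assume "(h x, h y) \<in> ?S"
    then obtain a b where ab: "(a, b) \<in> R" "h x = h a" "h y = h b" by auto
    then have "a \<in> ?A" "b \<in> ?A" using sub by auto
    then have "x = a" "y = b" using ab that inj by (auto dest: inj_onD)
    then show "(x, y) \<in> R" using ab by simp
  qed (auto intro: rev_image_eqI)
  have S_sub: "?S \<subseteq> h ` ?A \<times> h ` ?A"
  proof
    fix p assume "p \<in> ?S"
    then obtain a b where "(a, b) \<in> R" "p = (h a, h b)" by auto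
    then show "p \<in> h ` ?A \<times> h ` ?A" using sub by blast
  qed
  have "partial_order_on (h ` ?A) ?S"
    unfolding partial_order_on_def preorder_on_def
  proof (intro conjI S_sub)
    show "refl_on (h ` ?A) ?S"
      unfolding refl_on_def using iff rf by blast
    show "trans ?S"
    proof (rule transI)
      fix u v w assume uv: "(u, v) \<in> ?S" and vw: "(v, w) \<in> ?S"
      obtain a b where ab: "(a, b) \<in> R" "u = h a" "v = h b" using uv by auto
      obtain b' c where bc: "(b', c) \<in> R" "v = h b'" "w = h c" using vw by auto
      have "b' = b" by (rule inj_onD[OF inj]) (use ab bc sub in auto)
      then have "(a, c) \<in> R" using ab bc tr by (auto dest: transD)
      then show "(u, w) \<in> ?S" using ab bc by force
    qed
    show "antisym ?S"
    proof (rule antisymI)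
      fix u v assume uv: "(u, v) \<in> ?S" and vu: "(v, u) \<in> ?S"
      obtain a b where ab: "(a, b) \<in> R" "u = h a" "v = h b" using uv by auto
      have "a \<in> ?A" "b \<in> ?A" using ab sub by auto
      then have "(b, a) \<in> R" using iff[of b a] vu ab by simp
      then show "u = v" using ab an by (auto dest: antisymD)
    qed
  qed
  then have 1: "partial_order_on (h ` N \<union> Field (map_prod h h ` Q)) ?S"
    by (simp add: Field_map_prod_image image_Un)
  have 2: "Restr ?S (Field (map_prod h h ` Q)) = map_prod h h ` Q"
  proof (intro equalityI subsetI)
    fix p assume p: "p \<in> Restr ?S (Field (map_prod h h ` Q))"
    then obtain a b where ab: "a \<in> Field Q" "b \<in> Field Q" "p = (h a, h b)"
      by (auto simp: Field_map_prod_image)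
    then have "(a, b) \<in> R" using p iff by auto
    then have "(a, b) \<in> Q" using ab res by blast
    then show "p \<in> map_prod h h ` Q" using ab by force
  next
    fix p assume "p \<in> map_prod h h ` Q"
    then obtain a b where ab: "(a, b) \<in> Q" "p = (h a, h b)" by auto
    then have "(a, b) \<in> R" "a \<in> Field Q" "b \<in> Field Q" using res by (auto simp: Field_def)
    then show "p \<in> Restr ?S (Field (map_prod h h ` Q))"
      using ab by (force simp: Field_map_prod_image)
  qed
  have "minimal_elems ?S = h ` minimal_elems R"
  proof (intro equalityI subsetI)
    fix u assume u: "u \<in> minimal_elems ?S"
    then obtain x where x: "x \<in> ?A" "u = h x"
      by (auto simp: minimal_elems_def Field_map_prod_image FR)
    have "y = x" if "(y, x) \<in> R" for y
    proof -
      have "y \<in> ?A" using that sub by auto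
      moreover have "h y = h x" using that u x by (force simp: minimal_elems_def)
      ultimately show ?thesis using x inj by (auto dest: inj_onD)
    qed
    then show "u \<in> h ` minimal_elems R" using x FR by (auto simp: minimal_elems_def)
  next
    fix u assume "u \<in> h ` minimal_elems R"
    then obtain x where x: "x \<in> ?A" "u = h x" "\<And>y. (y, x) \<in> R \<Longrightarrow> y = x"
      by (auto simp: minimal_elems_def FR)
    have "v = u" if v: "(v, u) \<in> ?S" for v
    proof -
      obtain y where "y \<in> ?A" "v = h y" using v S_sub by blast
      moreover from this have "y = x" using iff[of y x] v x by simp
      ultimately show ?thesis using x by simp
    qed
    then show "u \<in> minimal_elems ?S" using x by (auto simp: minimal_elems_def Field_map_prod_image FR)
  qed
  then have 3: "minimal_elems ?S = h ` N" by (simp add: mi)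
  show ?thesis using 1 2 3 by (simp add: extension_orders_def)
qed

lemma extension_orders_sub:
  "R \<in> extension_orders N Q \<Longrightarrow> R \<subseteq> (N \<union> Field Q) \<times> (N \<union> Field Q)"
  by (auto simp: extension_orders_def partial_order_on_def preorder_on_def)

lemma card_extension_orders_image:
  assumes inj: "inj_on h (N \<union> Field Q)"
  shows "card (extension_orders (h ` N) (map_prod h h ` Q)) = card (extension_orders N Q)"
proof -
  let ?A = "N \<union> Field Q"
  define g where "g = inv_into ?A h"
  have gh: "g (h x) = x" if "x \<in> ?A" for x
    unfolding g_def using inj that by (rule inv_into_f_f)
  have injg: "inj_on g (h ` N \<union> Field (map_prod h h ` Q))"
    by (auto simp: Field_map_prod_image gh inj_on_def)
  have gh_im: "map_prod g g ` map_prod h h ` R = R" if "R \<subseteq> ?A \<times> ?A" for R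
  proof -
    have "map_prod g g (map_prod h h p) = p" if "p \<in> R" for p
      using that \<open>R \<subseteq> ?A \<times> ?A\<close> by (cases p) (auto simp: gh)
    then show ?thesis by (simp add: image_image)
  qed
  have hg_im: "map_prod h h ` map_prod g g ` R = R" if "R \<subseteq> h ` ?A \<times> h ` ?A" for R
  proof -
    have "map_prod h h (map_prod g g p) = p" if "p \<in> R" for p
      using that \<open>R \<subseteq> h ` ?A \<times> h ` ?A\<close> by (cases p) (auto simp: gh)
    then show ?thesis by (simp add: image_image)
  qed
  have gN: "g ` h ` N = N" using gh by (force simp: image_image)
  have gQ: "map_prod g g ` map_prod h h ` Q = Q"
    by (rule gh_im) (auto simp: Field_def)
  have "bij_betw (\<lambda>R. map_prod h h ` R) (extension_orders N Q)
    (extension_orders (h ` N) (map_prod h h ` Q))"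
  proof (rule bij_betw_byWitness[where f' = "\<lambda>R. map_prod g g ` R"])
    show "\<forall>R\<in>extension_orders N Q. map_prod g g ` map_prod h h ` R = R"
      by (intro ballI gh_im extension_orders_sub)
    show "\<forall>R\<in>extension_orders (h ` N) (map_prod h h ` Q).
        map_prod h h ` map_prod g g ` R = R"
    proof
      fix R assume "R \<in> extension_orders (h ` N) (map_prod h h ` Q)"
      from extension_orders_sub[OF this] show "map_prod h h ` map_prod g g ` R = R"
        by (intro hg_im) (simp add: Field_map_prod_image image_Un)
    qed
    show "(\<lambda>R. map_prod h h ` R) ` extension_orders N Q
        \<subseteq> extension_orders (h ` N) (map_prod h h ` Q)"
      by (intro image_subsetI extension_orders_image[OF inj])
    show "(\<lambda>R. map_prod g g ` R) ` extension_orders (h ` N) (map_prod h h ` Q)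
        \<subseteq> extension_orders N Q"
    proof (rule image_subsetI)
      fix R assume "R \<in> extension_orders (h ` N) (map_prod h h ` Q)"
      from extension_orders_image[OF injg this] show "map_prod g g ` R \<in> extension_orders N Q"
        by (simp only: gN gQ)
    qed
  qed
  then show ?thesis by (rule bij_betw_same_card[symmetric])
qed

lemma num_extensions_eq:
  fixes N :: "'a set" and Q :: "'a rel"
  assumes "finite N" "card N = n" "N \<inter> Field Q = {}"
  shows "num_extensions n Q = card (extension_orders N Q)"
proof -
  obtain b where b: "bij_betw b N {1..n}"
    using assms(1,2) by (metis card_atLeastAtMost diff_Suc_1 finite_atLeastAtMost finite_same_card_bij)
  define h :: "'a \<Rightarrow> nat + 'a" where "h x = (if x \<in> N then Inl (b x) else Inr x)" for x
  have inj: "inj_on h (N \<union> Field Q)"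
    using b by (auto simp: inj_on_def h_def bij_betw_def)
  have "h ` N = Inl ` b ` N" by (force simp: h_def)
  then have hN: "h ` N = Inl ` {1..n}" using b by (simp add: bij_betw_def)
  have hx: "h x = Inr x" if "x \<in> Field Q" for x using that assms(3) by (auto simp: h_def)
  have hQ: "map_prod h h ` Q = map_prod Inr Inr ` Q"
    by (rule image_cong) (auto simp: hx FieldI1 FieldI2)
  show ?thesis
    using card_extension_orders_image[OF inj] by (simp add: num_extensions_def hN hQ)
qed

end

theory Submission
  imports Defs
begin

text \<open>
  A partial order \<open>R\<close> counted by \<open>e(n,Q)\<close> is determined by the sets of minimal elements lying below
  the points of \<open>Q\<close>; these form a monotone family of subsets of \<open>N\<close>, nonempty because every point
  of a finite poset lies above a minimal one, and every such family arises. Hence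
  \<open>e(n,Q) = |F(N,Q)|\<close>. A monotone map \<open>g\<close> into the nonempty subsets of \<open>{1..m+1}\<close> is recovered from
  \<open>D = {x. g x = {m+1}}\<close>, from \<open>g x - {m+1}\<close> for \<open>x \<notin> D\<close>, and from the set of points outside the
  up-closure of \<open>D\<close> whose value contains \<open>m+1\<close>; inside the up-closure, \<open>m+1\<close> is forced by
  monotonicity. The two sums are exchanged by complementation of downsets.
\<close>

section \<open>Complementation, induced subposets and finiteness\<close>

lemma bij_betw_complement_downsets_upsets:
  "bij_betw (\<lambda>D. Field P - D) (downsets P) (upsets P)"
proof (rule bij_betw_byWitness[where f' = "\<lambda>U. Field P - U"])
  show "(\<lambda>D. Field P - D) ` downsets P \<subseteq> upsets P"
    by (auto simp: downsets_def upsets_def intro: FieldI2)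
  show "(\<lambda>U. Field P - U) ` upsets P \<subseteq> downsets P"
    by (auto simp: downsets_def upsets_def intro: FieldI1)
qed (auto simp: downsets_def upsets_def)

text \<open>Bridges the upsets \<open>U\<close> occurring in triples and the downset count d(P-DP)
  in the formula.\<close>

lemma card_upsets: "card (upsets P) = num_downsets P"
  using bij_betw_same_card[OF bij_betw_complement_downsets_upsets, of P]
  by (simp add: num_downsets_def)

lemma poset_on_poset_minus:
  "partial_order_on K P \<Longrightarrow> partial_order_on (K - S) (poset_minus P S)"
  by (simp add: poset_minus_def poset_on_Field poset_on_Restr)

lemma Field_poset_minus:
  "partial_order_on K P \<Longrightarrow> Field (poset_minus P S) = K - S"
  by (rule poset_on_Field[OF poset_on_poset_minus])

lemma mem_poset_minus:
  "partial_order_on K P \<Longrightarrow> (x, y) \<in> poset_minus P S \<longleftrightarrow> (x, y) \<in> P \<and> x \<notin> S \<and> y \<notin> S"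
  by (auto simp: poset_minus_def intro: FieldI1 FieldI2)

lemma finite_monotone_set_maps:
  assumes "finite N" "finite (Field Q)"
  shows "finite (monotone_set_maps N Q)"
proof (rule finite_subset)
  show "monotone_set_maps N Q \<subseteq> Field Q \<rightarrow>\<^sub>E (Pow N - {{}})"
    by (auto simp: monotone_set_maps_def)
  show "finite (Field Q \<rightarrow>\<^sub>E (Pow N - {{}}))"
    using assms by (intro finite_PiE) auto
qed

lemma finite_downsets: "finite (Field P) \<Longrightarrow> finite (downsets P)"
  by (rule finite_subset[where B = "Pow (Field P)"]) (auto simp: downsets_def)

lemma finite_upsets: "finite (Field P) \<Longrightarrow> finite (upsets P)"
  by (rule finite_subset[where B = "Pow (Field P)"]) (auto simp: upsets_def)

section \<open>Extension orders as monotone set-valued maps\<close>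

definition minimal_below :: "'b set \<Rightarrow> 'a rel \<Rightarrow> ('b + 'a) rel \<Rightarrow> 'a \<Rightarrow> 'b set" where
  "minimal_below N Q R = (\<lambda>x\<in>Field Q. {k \<in> N. (Inl k, Inr x) \<in> R})"

text \<open>Candidate inverse of \<open>minimal_below\<close>. On \<open>N\<close> it is only the
  diagonal, so the new points form an antichain, and nothing from \<open>Q\<close> lies below
  them.\<close>

definition adjoin_minimal :: "'b set \<Rightarrow> 'a rel \<Rightarrow> ('a \<Rightarrow> 'b set) \<Rightarrow> ('b + 'a) rel" where
  "adjoin_minimal N Q f = map_prod Inr Inr ` Q \<union> Id_on (Inl ` N) \<union>
     {(Inl k, Inr x) | k x. x \<in> Field Q \<and> k \<in> f x}"

lemma mem_adjoin_minimal [simp]: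
  "(Inr x, Inr y) \<in> adjoin_minimal N Q f \<longleftrightarrow> (x, y) \<in> Q"
  "(Inl k, Inl l) \<in> adjoin_minimal N Q f \<longleftrightarrow> k = l \<and> k \<in> N"
  "(Inl k, Inr x) \<in> adjoin_minimal N Q f \<longleftrightarrow> x \<in> Field Q \<and> k \<in> f x"
  "(Inr x, Inl k) \<notin> adjoin_minimal N Q f"
  by (auto simp: adjoin_minimal_def)

text \<open>Splits an equality of relations into its four blocks, matching the shape of
  \<open>mem_adjoin_minimal\<close>.\<close>

lemma sum_rel_eqI:
  fixes R S :: "('a + 'b) rel"
  assumes "\<And>k l. (Inl k, Inl l) \<in> R \<longleftrightarrow> (Inl k, Inl l) \<in> S"
    and "\<And>k x. (Inl k, Inr x) \<in> R \<longleftrightarrow> (Inl k, Inr x) \<in> S"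
    and "\<And>x k. (Inr x, Inl k) \<in> R \<longleftrightarrow> (Inr x, Inl k) \<in> S"
    and "\<And>x y. (Inr x, Inr y) \<in> R \<longleftrightarrow> (Inr x, Inr y) \<in> S"
  shows "R = S"
proof -
  have "(u, v) \<in> R \<longleftrightarrow> (u, v) \<in> S" for u v
    by (cases u; cases v) (simp_all add: assms)
  then show ?thesis by auto
qed

text \<open>Monotonicity of \<open>f\<close> is what transitivity asks of the mixed pairs, and
  nonemptiness of each \<open>f x\<close> keeps the points of \<open>L\<close> from being
  minimal.\<close>

lemma adjoin_minimal_in_extension_orders:
  assumes Q: "partial_order_on L Q" and f: "f \<in> monotone_set_maps N Q"
  shows "adjoin_minimal N Q f \<in> extension_orders (Inl ` N) (map_prod Inr Inr ` Q)"
proof -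
  let ?R = "adjoin_minimal N Q f" and ?A = "Inl ` N \<union> Inr ` L"
  have FQ: "Field Q = L" using Q by (rule poset_on_Field)
  have Qsub: "Q \<subseteq> L \<times> L" and Qrefl: "\<And>x. x \<in> L \<Longrightarrow> (x, x) \<in> Q"
    and Qtrans: "trans Q" and Qanti: "antisym Q"
    using Q by (auto simp: partial_order_on_def preorder_on_def refl_on_def)
  have fN: "f x \<subseteq> N" "f x \<noteq> {}" if "x \<in> L" for x
    using f that FQ by (auto simp: monotone_set_maps_def PiE_iff)
  have fmono: "f x \<subseteq> f y" if "(x, y) \<in> Q" for x y
    using f that by (auto simp: monotone_set_maps_def)
  have sub: "?R \<subseteq> ?A \<times> ?A"
    using Qsub fN FQ by (auto simp: adjoin_minimal_def)
  have refl: "(u, u) \<in> ?R" if "u \<in> ?A" for u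
    using that Qrefl by auto
  have po: "partial_order_on ?A ?R"
    unfolding partial_order_on_def preorder_on_def
  proof (intro conjI sub)
    show "refl_on ?A ?R" using refl by (auto simp: refl_on_def)
    show "trans ?R"
    proof (rule transI)
      fix u v w assume "(u, v) \<in> ?R" "(v, w) \<in> ?R"
      \<comment> \<open>The chain \<open>Inl k\<close>, \<open>Inr x\<close>, \<open>Inr y\<close>
        is the one that uses \<open>fmono\<close>; a chain inside \<open>Q\<close> uses transitivity
        of \<open>Q\<close>.\<close>
      then show "(u, w) \<in> ?R"
        using transD[OF Qtrans]
        by (cases u; cases v; cases w) (auto intro: FieldI2 fmono[THEN subsetD])
    qed
    show "antisym ?R"
    proof (rule antisymI)
      fix u v assume "(u, v) \<in> ?R" "(v, u) \<in> ?R"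
      then show "u = v" using Qanti by (cases u; cases v) (auto dest: antisymD)
    qed
  qed
  have "Restr ?R (Inr ` L) = map_prod Inr Inr ` Q"
    using Qsub by (intro sum_rel_eqI) auto
  moreover have "minimal_elems ?R = Inl ` N"
  proof (intro equalityI subsetI)
    fix u assume u: "u \<in> minimal_elems ?R"
    then have "u \<in> ?A" by (simp add: minimal_elems_def poset_on_Field[OF po])
    moreover have "u \<noteq> Inr x" if x: "x \<in> L" for x
    proof
      assume "u = Inr x"
      obtain k where "k \<in> f x" using fN(2)[OF x] by blast
      then have "(Inl k, u) \<in> ?R" using x FQ \<open>u = Inr x\<close> by simp
      then have "Inl k = u" using u unfolding minimal_elems_def by blast
      then show False using \<open>u = Inr x\<close> by simp
    qed
    ultimately show "u \<in> Inl ` N" by blast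
  next
    fix u :: "'b + 'a" assume "u \<in> Inl ` N"
    moreover have "v = Inl k" if "(v, Inl k) \<in> ?R" for v k
      using that by (cases v) auto
    ultimately show "u \<in> minimal_elems ?R"
      by (auto simp: minimal_elems_def poset_on_Field[OF po])
  qed
  ultimately show ?thesis
    using po by (simp add: extension_orders_def Field_map_prod_image FQ)
qed

text \<open>Monotonicity is transitivity of \<open>R\<close>. Nonemptiness rests on finiteness:
  descend from \<open>x\<close> to a \<open>Q\<close>-minimal point, which must still have something
  of \<open>N\<close> below it.\<close>

lemma minimal_below_in_monotone_set_maps:
  assumes fin: "finite L" and Q: "partial_order_on L Q"
    and R: "R \<in> extension_orders (Inl ` N) (map_prod Inr Inr ` Q)"
  shows "minimal_below N Q R \<in> monotone_set_maps N Q"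
proof -
  have FQ: "Field Q = L" using Q by (rule poset_on_Field)
  have po: "partial_order_on (Inl ` N \<union> Inr ` L) R"
    and res: "Restr R (Inr ` L) = map_prod Inr Inr ` Q"
    and mi: "minimal_elems R = Inl ` N"
    using R by (auto simp: extension_orders_def Field_map_prod_image FQ)
  have Rsub: "R \<subseteq> (Inl ` N \<union> Inr ` L) \<times> (Inl ` N \<union> Inr ` L)" and Rtrans: "trans R"
    using po by (auto simp: partial_order_on_def preorder_on_def)
  have QR: "(Inr x, Inr y) \<in> R" if "(x, y) \<in> Q" for x y
    using that res by force
  have RQ: "(x, y) \<in> Q" if "(Inr x, Inr y) \<in> R" for x y
  proof -
    have "(Inr x, Inr y) \<in> Restr R (Inr ` L)" using that Rsub by auto
    then show ?thesis unfolding res by auto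
  qed
  have ne: "\<exists>k\<in>N. (Inl k, Inr x) \<in> R" if "x \<in> L" for x
  proof -
    have "finite Q"
      using Q fin by (auto simp: partial_order_on_def preorder_on_def finite_subset)
    \<comment> \<open>Well-foundedness of the strict order supplies a \<open>Q\<close>-minimal
      \<open>z\<close> among the points below \<open>x\<close>.\<close>
    then have "wf (Q - Id)"
      using partial_order_on_acyclic[OF Q] by (simp add: finite_acyclic_wf)
    moreover have "x \<in> {y. (y, x) \<in> Q}"
      using Q that by (auto simp: partial_order_on_def preorder_on_def refl_on_def)
    ultimately obtain z where z: "(z, x) \<in> Q"
      and zmin: "\<And>y. (y, z) \<in> Q - Id \<Longrightarrow> (y, x) \<notin> Q"
      by (elim wfE_min[where Q = "{y. (y, x) \<in> Q}"]) auto
    have zL: "z \<in> L" using z FQ by (auto intro: FieldI1)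
    \<comment> \<open>All minimal elements of \<open>R\<close> are tagged \<open>Inl\<close>, so
      \<open>z\<close> has a proper predecessor \<open>v\<close>; a \<open>v\<close> from
      \<open>L\<close> would contradict the choice of \<open>z\<close>.\<close>
    have "Inr z \<notin> minimal_elems R" by (auto simp: mi)
    then obtain v where v: "(v, Inr z) \<in> R" "v \<noteq> Inr z"
      using zL by (auto simp: minimal_elems_def poset_on_Field[OF po])
    have "v \<noteq> Inr y" for y
    proof
      assume "v = Inr y"
      then have "(y, z) \<in> Q - Id" using v RQ by auto
      moreover from this have "(y, x) \<in> Q"
        using z Q by (auto simp: partial_order_on_def preorder_on_def elim: transE)
      ultimately show False using zmin by blast
    qed
    then obtain k where "k \<in> N" "v = Inl k" using v Rsub by blast
    then show ?thesis using transD[OF Rtrans v(1) QR[OF z]] by blast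
  qed
  have "minimal_below N Q R x \<subseteq> minimal_below N Q R y" if "(x, y) \<in> Q" for x y
    using that transD[OF Rtrans _ QR[OF that]]
    by (auto simp: minimal_below_def FieldI1[OF that] FieldI2[OF that])
  moreover have "minimal_below N Q R \<in> Field Q \<rightarrow>\<^sub>E (Pow N - {{}})"
    using ne FQ by (auto simp: minimal_below_def)
  ultimately show ?thesis unfolding monotone_set_maps_def by blast
qed

text \<open>Minimality of \<open>N\<close> and the restriction to \<open>Q\<close> determine every
  block of \<open>R\<close> except the pairs from \<open>N\<close> to \<open>L\<close>, and
  \<open>minimal_below\<close> records exactly those.\<close>

lemma bij_betw_minimal_below:
  assumes fin: "finite L" and Q: "partial_order_on L Q"
  shows "bij_betw (minimal_below N Q)
    (extension_orders (Inl ` N) (map_prod Inr Inr ` Q)) (monotone_set_maps N Q)"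
proof (rule bij_betw_byWitness[where f' = "adjoin_minimal N Q"])
  have FQ: "Field Q = L" using Q by (rule poset_on_Field)
  show "\<forall>R\<in>extension_orders (Inl ` N) (map_prod Inr Inr ` Q).
      adjoin_minimal N Q (minimal_below N Q R) = R"
  proof
    fix R :: "('b + 'a) rel"
    assume R: "R \<in> extension_orders (Inl ` N) (map_prod Inr Inr ` Q)"
    have po: "partial_order_on (Inl ` N \<union> Inr ` L) R"
      and res: "Restr R (Inr ` L) = map_prod Inr Inr ` Q"
      and mi: "minimal_elems R = Inl ` N"
      using R by (auto simp: extension_orders_def Field_map_prod_image FQ)
    have Rsub: "R \<subseteq> (Inl ` N \<union> Inr ` L) \<times> (Inl ` N \<union> Inr ` L)"
      and Rrefl: "\<And>u. u \<in> Inl ` N \<union> Inr ` L \<Longrightarrow> (u, u) \<in> R"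
      using po by (auto simp: partial_order_on_def preorder_on_def refl_on_def)
    \<comment> \<open>Fixes both blocks ending in \<open>Inl\<close>: the first is the diagonal of
      \<open>N\<close>, the second is empty.\<close>
    have min: "u = Inl k" if "(u, Inl k) \<in> R" for u k
    proof -
      have "Inl k \<in> minimal_elems R" using that Rsub by (auto simp: mi)
      then show ?thesis using that by (auto simp: minimal_elems_def)
    qed
    have RQ: "(Inr x, Inr y) \<in> R \<longleftrightarrow> (x, y) \<in> Q" for x y
    proof -
      have "(Inr x, Inr y) \<in> R \<longleftrightarrow> (Inr x, Inr y) \<in> Restr R (Inr ` L)" using Rsub by auto
      then show ?thesis unfolding res by auto
    qed
    show "adjoin_minimal N Q (minimal_below N Q R) = R"
    proof (rule sum_rel_eqI)
      show "(Inl k, Inl l) \<in> adjoin_minimal N Q (minimal_below N Q R) \<longleftrightarrow> (Inl k, Inl l) \<in> R"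
        for k l using min[of "Inl k" l] Rrefl Rsub by auto
      show "(Inl k, Inr x) \<in> adjoin_minimal N Q (minimal_below N Q R) \<longleftrightarrow> (Inl k, Inr x) \<in> R"
        for k x using Rsub FQ by (auto simp: minimal_below_def)
      show "(Inr x, Inl k) \<in> adjoin_minimal N Q (minimal_below N Q R) \<longleftrightarrow> (Inr x, Inl k) \<in> R"
        for x k using min[of "Inr x" k] by auto
    qed (simp add: RQ)
  qed
  show "\<forall>f\<in>monotone_set_maps N Q. minimal_below N Q (adjoin_minimal N Q f) = f"
  proof
    fix f assume f: "f \<in> monotone_set_maps N Q"
    then have "f \<in> Field Q \<rightarrow>\<^sub>E (Pow N - {{}})" by (simp add: monotone_set_maps_def)
    \<comment> \<open>Inside \<open>Field Q\<close> this uses that \<open>f x\<close> lies in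
      \<open>N\<close>; outside, both sides are \<open>undefined\<close>.\<close>
    then show "minimal_below N Q (adjoin_minimal N Q f) = f"
      by (intro ext) (auto simp: minimal_below_def PiE_iff extensional_def)
  qed
  show "minimal_below N Q ` extension_orders (Inl ` N) (map_prod Inr Inr ` Q)
      \<subseteq> monotone_set_maps N Q"
    using minimal_below_in_monotone_set_maps[OF fin Q] by blast
  show "adjoin_minimal N Q ` monotone_set_maps N Q
      \<subseteq> extension_orders (Inl ` N) (map_prod Inr Inr ` Q)"
    using adjoin_minimal_in_extension_orders[OF Q] by blast
qed

text \<open>The tagged labels built into \<open>num_extensions\<close> are those of the preceding
  bijection at \<open>N = {1..n}\<close>.\<close>

lemma num_extensions_eq_card_monotone_set_maps:
  assumes "finite L" and "partial_order_on L Q"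
  shows "num_extensions n Q = card (monotone_set_maps {1..n} Q)"
  unfolding num_extensions_def by (rule bij_betw_same_card[OF bij_betw_minimal_below[OF assms]])

section \<open>Splitting off the value \<open>m + 1\<close>\<close>

definition remove_point_map ::
  "nat \<Rightarrow> 'a rel \<Rightarrow> ('a \<Rightarrow> nat set) \<Rightarrow> 'a set \<times> 'a set \<times> ('a \<Rightarrow> nat set)" where
  "remove_point_map m P g =
    (let D = {x \<in> Field P. g x = {m + 1}} in
      (D, {x \<in> Field P. m + 1 \<in> g x} - up_closure P D, \<lambda>x\<in>Field P - D. g x - {m + 1}))"

lemma downset_subset_up_closure:
  "partial_order_on K P \<Longrightarrow> D \<in> downsets P \<Longrightarrow> D \<subseteq> up_closure P D"
  unfolding up_closure_def downsets_def partial_order_on_def preorder_on_def refl_on_def Field_def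
  by blast

text \<open>Unfolds the induced subposets into pointwise facts about \<open>P\<close>. By the fourth
  fact, going up from \<open>U\<close> stays in \<open>U\<close> or enters DP; with
  \<open>up_closure_closed\<close> this makes the union of \<open>U\<close> and DP an upset of
  \<open>P\<close>.\<close>

lemma map_triplesD:
  assumes P: "partial_order_on K P" and t: "(D, U, f) \<in> map_triples M P"
  shows "D \<subseteq> K"
    and "\<And>x y. y \<in> D \<Longrightarrow> (x, y) \<in> P \<Longrightarrow> x \<in> D"
    and "U \<subseteq> K - up_closure P D"
    and "\<And>x y. x \<in> U \<Longrightarrow> (x, y) \<in> P \<Longrightarrow> y \<in> U \<union> up_closure P D"
    and "f \<in> K - D \<rightarrow>\<^sub>E (Pow M - {{}})"
    and "\<And>x y. (x, y) \<in> P \<Longrightarrow> x \<notin> D \<Longrightarrow> y \<notin> D \<Longrightarrow> f x \<subseteq> f y"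
    and "D \<subseteq> up_closure P D"
proof -
  have D: "D \<in> downsets P" and U: "U \<in> upsets (poset_minus P (up_closure P D))"
    and f: "f \<in> monotone_set_maps M (poset_minus P D)"
    using t by (auto simp: map_triples_def)
  show "D \<subseteq> K" "\<And>x y. y \<in> D \<Longrightarrow> (x, y) \<in> P \<Longrightarrow> x \<in> D"
    using D by (auto simp: downsets_def poset_on_Field[OF P])
  show UK: "U \<subseteq> K - up_closure P D"
    using U by (auto simp: upsets_def Field_poset_minus[OF P])
  show "\<And>x y. x \<in> U \<Longrightarrow> (x, y) \<in> P \<Longrightarrow> y \<in> U \<union> up_closure P D"
    using U UK by (auto simp: upsets_def mem_poset_minus[OF P])
  show "f \<in> K - D \<rightarrow>\<^sub>E (Pow M - {{}})"
    using f by (simp add: monotone_set_maps_def Field_poset_minus[OF P])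
  show "\<And>x y. (x, y) \<in> P \<Longrightarrow> x \<notin> D \<Longrightarrow> y \<notin> D \<Longrightarrow> f x \<subseteq> f y"
    using f by (fastforce simp: monotone_set_maps_def mem_poset_minus[OF P])
  show "D \<subseteq> up_closure P D" using P D by (rule downset_subset_up_closure)
qed

lemma up_closure_closed:
  "partial_order_on K P \<Longrightarrow> x \<in> up_closure P S \<Longrightarrow> (x, y) \<in> P \<Longrightarrow> y \<in> up_closure P S"
  by (auto simp: up_closure_def partial_order_on_def preorder_on_def dest: transD)

text \<open>The new value \<open>m + 1\<close> is present exactly on the union of \<open>U\<close>
  and DP, an upset, while the old values are governed by \<open>f\<close>.\<close>

lemma add_point_map_in_monotone_set_maps:
  assumes P: "partial_order_on K P" and t: "(D, U, f) \<in> map_triples {1..m} P"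
  shows "add_point_map m P (D, U, f) \<in> monotone_set_maps {1..m+1} P"
proof -
  note T = map_triplesD[OF P t]
  have FP: "Field P = K" using P by (rule poset_on_Field)
  let ?g = "add_point_map m P (D, U, f)"
  have fx: "f x \<subseteq> {1..m}" "f x \<noteq> {}" if "x \<in> K" "x \<notin> D" for x
    using T(5) that by (auto simp: PiE_iff)
  have "?g x \<in> Pow {1..m+1} - {{}}" if "x \<in> K" for x
    using that fx[of x] by (force simp: add_point_map_def FP)
  then have "?g \<in> K \<rightarrow>\<^sub>E (Pow {1..m+1} - {{}})"
    by (auto simp: PiE_iff add_point_map_def FP)
  moreover have "?g x \<subseteq> ?g y" if xy: "(x, y) \<in> P" for x y
  proof -
    have K: "x \<in> K" "y \<in> K" using xy FP by (auto intro: FieldI1 FieldI2)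
    have up: "y \<in> U \<union> up_closure P D" if "x \<in> U \<union> up_closure P D"
      using that T(4) xy up_closure_closed[OF P _ xy] by blast
    \<comment> \<open>If \<open>y\<close> is in \<open>D\<close>, so is \<open>x\<close>, and both
      values are \<open>{m + 1}\<close>. If only \<open>x\<close> is in \<open>D\<close>, then
      \<open>y\<close> lies in DP and its value contains \<open>m + 1\<close>. Otherwise
      \<open>f\<close> and \<open>m + 1\<close> are compared separately.\<close>
    consider "y \<in> D" | "x \<in> D" "y \<notin> D" | "x \<notin> D" "y \<notin> D" by blast
    then show ?thesis
    proof cases
      case 1
      then show ?thesis using T(2) xy K by (simp add: add_point_map_def FP)
    next
      case 2
      then show ?thesis using up T(7) K by (auto simp: add_point_map_def FP)
    next
      case 3
      then show ?thesis using up T(6)[OF xy] K by (auto simp: add_point_map_def FP)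
    qed
  qed
  ultimately show ?thesis unfolding monotone_set_maps_def FP by blast
qed

lemma remove_point_map_in_map_triples:
  assumes P: "partial_order_on K P" and g: "g \<in> monotone_set_maps {1..m+1} P"
  shows "remove_point_map m P g \<in> map_triples {1..m} P"
proof -
  have FP: "Field P = K" using P by (rule poset_on_Field)
  have gx: "g x \<subseteq> {1..m+1}" "g x \<noteq> {}" if "x \<in> K" for x
    using g that by (auto simp: monotone_set_maps_def PiE_iff FP)
  have mono: "g x \<subseteq> g y" if "(x, y) \<in> P" for x y
    using g that by (auto simp: monotone_set_maps_def)
  have PK: "x \<in> K" "y \<in> K" if "(x, y) \<in> P" for x y
    using that FP by (auto intro: FieldI1 FieldI2)
  define D where "D = {x \<in> K. g x = {m + 1}}"
  define U where "U = {x \<in> K. m + 1 \<in> g x} - up_closure P D"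
  define f where "f = (\<lambda>x\<in>K - D. g x - {m + 1})"
  \<comment> \<open>A nonempty subset of the singleton \<open>{m + 1}\<close> is the singleton
    itself.\<close>
  have "x \<in> D" if "y \<in> D" "(x, y) \<in> P" for x y
  proof -
    have "g x \<subseteq> {m + 1}" "g x \<noteq> {}" "x \<in> K"
      using that mono[of x y] gx(2)[of x] PK[of x y] by (auto simp: D_def)
    then show ?thesis by (auto simp: D_def)
  qed
  moreover have "D \<subseteq> K" by (auto simp: D_def)
  ultimately have "D \<in> downsets P" unfolding downsets_def FP by blast
  \<comment> \<open>Monotonicity carries \<open>m + 1\<close> upwards, and points of DP are absent
    from this subposet.\<close>
  moreover have "U \<in> upsets (poset_minus P (up_closure P D))"
    using mono PK
    by (auto simp: upsets_def U_def Field_poset_minus[OF P] mem_poset_minus[OF P])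
  moreover have "f \<in> monotone_set_maps {1..m} (poset_minus P D)"
  proof -
    have "f x \<in> Pow {1..m} - {{}}" if x: "x \<in> K - D" for x
    proof -
      have "g x - {m + 1} \<subseteq> {1..m}" using gx(1)[of x] x by fastforce
      \<comment> \<open>The value \<open>{m + 1}\<close> is excluded because \<open>x\<close> is
        outside \<open>D\<close>.\<close>
      moreover have "g x - {m + 1} \<noteq> {}" using gx(2)[of x] x by (auto simp: D_def)
      ultimately show ?thesis using x by (simp add: f_def)
    qed
    then have "f \<in> K - D \<rightarrow>\<^sub>E (Pow {1..m} - {{}})" by (auto simp: PiE_iff f_def)
    moreover have "f x \<subseteq> f y" if "(x, y) \<in> poset_minus P D" for x y
    proof -
      have xy: "(x, y) \<in> P" "x \<notin> D" "y \<notin> D" using that by (simp_all add: mem_poset_minus[OF P])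
      then show ?thesis using mono[OF xy(1)] PK[OF xy(1)] by (auto simp: f_def)
    qed
    ultimately show ?thesis
      unfolding monotone_set_maps_def Field_poset_minus[OF P] by blast
  qed
  moreover have "remove_point_map m P g = (D, U, f)"
    by (simp add: remove_point_map_def Let_def D_def U_def f_def FP)
  ultimately show ?thesis by (simp add: map_triples_def)
qed

text \<open>Off \<open>D\<close> the values of \<open>f\<close> are nonempty and omit
  \<open>m + 1\<close>, so they neither imitate the value on \<open>D\<close> nor hide the added
  point.\<close>

lemma remove_add_point_map:
  assumes P: "partial_order_on K P" and t: "(D, U, f) \<in> map_triples {1..m} P"
  shows "remove_point_map m P (add_point_map m P (D, U, f)) = (D, U, f)"
proof -
  note T = map_triplesD[OF P t]
  have FP: "Field P = K" using P by (rule poset_on_Field)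
  let ?g = "add_point_map m P (D, U, f)"
  have fx: "m + 1 \<notin> f x" "f x \<noteq> {}" if "x \<in> K" "x \<notin> D" for x
    using T(5) that by (force simp: PiE_iff)+
  have g_D: "?g x = {m + 1} \<longleftrightarrow> x \<in> D" if "x \<in> K" for x
    using that fx[of x] by (auto simp: add_point_map_def FP)
  have D: "{x \<in> K. ?g x = {m + 1}} = D" using g_D T(1) by blast
  \<comment> \<open>Since \<open>D\<close> lies in DP, the points carrying \<open>m + 1\<close> are
    those of \<open>U\<close> and DP together; \<open>U\<close> is disjoint from DP, so subtracting
    DP returns \<open>U\<close>.\<close>
  have g_m: "m + 1 \<in> ?g x \<longleftrightarrow> x \<in> U \<union> up_closure P D" if "x \<in> K" for x
    using that fx(1)[of x] T(7) by (auto simp: add_point_map_def FP)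
  have U: "{x \<in> K. m + 1 \<in> ?g x} - up_closure P D = U" using g_m T(3) by blast
  have "(\<lambda>x\<in>K - D. ?g x - {m + 1}) = f"
  proof
    \<comment> \<open>Outside \<open>K - D\<close> both functions are \<open>undefined\<close>, as
      \<open>f\<close> is extensional there.\<close>
    fix x show "(\<lambda>x\<in>K - D. ?g x - {m + 1}) x = f x"
      using T(5) fx(1)[of x] by (auto simp: add_point_map_def FP PiE_iff extensional_def)
  qed
  then show ?thesis using D U by (simp add: remove_point_map_def Let_def FP)
qed

lemma add_remove_point_map:
  assumes P: "partial_order_on K P" and g: "g \<in> monotone_set_maps {1..m+1} P"
  shows "add_point_map m P (remove_point_map m P g) = g"
proof
  fix x
  have FP: "Field P = K" using P by (rule poset_on_Field)
  have ext: "g x = undefined" if "x \<notin> K"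
    using g that by (auto simp: monotone_set_maps_def PiE_iff extensional_def FP)
  let ?D = "{x \<in> K. g x = {m + 1}}"
  \<comment> \<open>Adding \<open>m + 1\<close> throughout DP is correct because monotonicity
    already forces it there; elsewhere \<open>U\<close> remembers whether it occurred.\<close>
  have "m + 1 \<in> g x" if x: "x \<in> up_closure P ?D"
  proof -
    obtain s where "(s, x) \<in> P" "g s = {m + 1}" using x unfolding up_closure_def by blast
    then show ?thesis using g by (auto simp: monotone_set_maps_def)
  qed
  then show "add_point_map m P (remove_point_map m P g) x = g x"
    using ext by (auto simp: add_point_map_def remove_point_map_def Let_def FP)
qed

lemma bij_betw_add_point_map:
  assumes P: "partial_order_on K P"
  shows "bij_betw (add_point_map m P) (map_triples {1..m} P) (monotone_set_maps {1..m+1} P)"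
  using remove_add_point_map[OF P] add_remove_point_map[OF P]
    add_point_map_in_monotone_set_maps[OF P] remove_point_map_in_map_triples[OF P]
  by (intro bij_betw_byWitness[where f' = "remove_point_map m P"]) auto

section \<open>Counting triples and the two sum formulas\<close>

lemma card_map_triples:
  assumes fin: "finite K" "finite M" and P: "partial_order_on K P"
  shows "card (map_triples M P) =
    (\<Sum>D\<in>downsets P. num_downsets (poset_minus P (up_closure P D)) *
      card (monotone_set_maps M (poset_minus P D)))"
proof -
  let ?B = "\<lambda>D. upsets (poset_minus P (up_closure P D)) \<times> monotone_set_maps M (poset_minus P D)"
  have "map_triples M P = Sigma (downsets P) ?B" by (auto simp: map_triples_def)
  \<comment> \<open>For fixed \<open>D\<close> the choices of \<open>U\<close> and \<open>f\<close>
    are independent, so each fibre of the \<open>Sigma\<close> is a product; finiteness is needed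
    for its cardinality to become a sum.\<close>
  moreover have "finite (downsets P)"
    using fin by (intro finite_downsets) (simp add: poset_on_Field[OF P])
  moreover have "finite (?B D)" for D
    using fin by (intro finite_cartesian_product finite_upsets finite_monotone_set_maps)
      (simp_all add: Field_poset_minus[OF P])
  ultimately show ?thesis
    by (simp add: card_cartesian_product card_upsets)
qed

theorem theorem5p2:
  fixes m :: nat and K :: "'a set" and P :: "'a rel"
  assumes "m \<ge> 1" and "finite K" and "partial_order_on K P"
  shows "bij_betw (add_point_map m P) (map_triples {1..m} P) (monotone_set_maps {1..m+1} P)
    \<and> num_extensions (m + 1) P =
        (\<Sum>D\<in>downsets P. num_downsets (poset_minus P (up_closure P D)) *
                            num_extensions m (poset_minus P D))
    \<and> (\<Sum>D\<in>downsets P. num_downsets (poset_minus P (up_closure P D)) *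
                            num_extensions m (poset_minus P D)) =
        (\<Sum>U\<in>upsets P. num_downsets (Restr P (up_interior P U)) *
                          num_extensions m (Restr P U))"
proof (intro conjI)
  note fin = \<open>finite K\<close> and P = \<open>partial_order_on K P\<close>
  show bij: "bij_betw (add_point_map m P) (map_triples {1..m} P) (monotone_set_maps {1..m+1} P)"
    using P by (rule bij_betw_add_point_map)
  \<comment> \<open>Turns each e(m,P-D) into the fibre factor of
    \<open>card_map_triples\<close>.\<close>
  have "num_extensions m (poset_minus P D) = card (monotone_set_maps {1..m} (poset_minus P D))"
    for D
    using fin
    by (intro num_extensions_eq_card_monotone_set_maps[OF _ poset_on_poset_minus[OF P]]) simp
  then show "num_extensions (m + 1) P =
      (\<Sum>D\<in>downsets P. num_downsets (poset_minus P (up_closure P D)) *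
                          num_extensions m (poset_minus P D))"
    using num_extensions_eq_card_monotone_set_maps[OF fin P, of "m + 1"]
      bij_betw_same_card[OF bij] card_map_triples[OF fin _ P, of "{1..m}"]
    by simp
  show "(\<Sum>D\<in>downsets P. num_downsets (poset_minus P (up_closure P D)) *
                            num_extensions m (poset_minus P D)) =
        (\<Sum>U\<in>upsets P. num_downsets (Restr P (up_interior P U)) *
                          num_extensions m (Restr P U))"
  \<comment> \<open>The sum over upsets is pulled back along U = K - D.\<close>
  proof (subst sum.reindex_bij_betw[OF bij_betw_complement_downsets_upsets, symmetric],
      rule sum.cong[OF refl])
    fix D assume "D \<in> downsets P"
    \<comment> \<open>Hence the interior of K - D is K - DP, which identifies the first factors; the
      second agree by definition.\<close>
    then have "Field P - (Field P - D) = D" by (auto simp: downsets_def)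
    then show "num_downsets (poset_minus P (up_closure P D)) * num_extensions m (poset_minus P D) =
        num_downsets (Restr P (up_interior P (Field P - D))) *
        num_extensions m (Restr P (Field P - D))"
      by (simp add: poset_minus_def up_interior_def)
  qed
qed

end
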